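(* Let $N \geq 1$ be an integer and $\alpha > 2(N-1)$ a real number. Then $$\min_{a_0, \ldots, a_{n-1} \in \mathbb{T}} \Big\| \sum_{k=0}^{n-1} \frac{1}{(z-a_k)^N} \Big\|_\alpha \asymp \|\Psi_n^N\|_\alpha,$$ that is, there exist constants $c, C > 0$, independent of $n$, such that for every integer $n \geq 1$ the left-hand side lies between $c\,\|\Psi_n^N\|_\alpha$ and $C\,\|\Psi_n^N\|_\alpha$.
   Context: $\mathbb{D}$ is the open unit disc, $\mathbb{T}$ the unit circle. For $\alpha > -1$ and $f$ holomorphic on $\mathbb{D}$, $\|f\|_\alpha^2 = (\alpha+1)\int_{\mathbb{D}} |f(z)|^2 (1-|z|^2)^\alpha \, dA(z)$, where $dA$ is Lebesgue area measure normalized so that $\mathbb{D}$ has measure $1$. $\Psi_n^N(z) = \sum_{0 \leq k < n} \frac{1}{(z - e^{2\pi i k/n})^N}$. *)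

theory Defs
  imports "HOL-Analysis.Analysis"
begin

definition disc_area :: "complex measure" where
  "disc_area = uniform_measure lborel (ball 0 1)"

(* Meaningful for functions whose weighted square integral is finite; the Bochner integral
   of a function that is not integrable is 0. *)
definition bergman_norm :: "real \<Rightarrow> (complex \<Rightarrow> complex) \<Rightarrow> real" where
  "bergman_norm \<alpha> f =
     sqrt ((\<alpha> + 1) * (LINT z|disc_area. (cmod (f z))\<^sup>2 * (1 - (cmod z)\<^sup>2) powr \<alpha>))"

definition Psi :: "nat \<Rightarrow> nat \<Rightarrow> complex \<Rightarrow> complex" where
  "Psi N n z = (\<Sum>k<n. 1 / (z - exp (2 * of_real pi * \<i> * of_nat k / of_nat n)) ^ N)"

end

theory Submission
  imports Defs
begin

text \<open>
  On the disc \<open>\<Sum>k<n. 1 / (z - a k) ^ N\<close> has the Taylor coefficients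
  \<open>(-1) ^ N * (j + N - 1 choose N - 1) * s (j + N)\<close>, where \<open>s m = (\<Sum>k<n. cnj (a k) ^ m)\<close>,
  and monomials are orthogonal for a rotation-invariant measure. Hence the squared norm is comparable
  with \<open>\<Sum>m\<ge>N. m powr \<beta> * \<bar>s m\<bar>\<^sup>2\<close> for \<open>\<beta> = 2 * N - 3 - \<alpha> < -1\<close>. This series converges uniformly on
  the compact torus, so a minimum exists, and it is at most the value at the roots of unity. There
  \<open>s m\<close> vanishes unless \<open>n\<close> divides \<open>m\<close>, so the series is of order \<open>n\<^sup>2 * n powr \<beta>\<close>. For arbitrary
  points, positivity of the Fejer kernel yields
  \<open>n\<^sup>2 \<le> (\<Sum>m\<in>{N..<(2 * N + 1) * n}. \<bar>s m\<bar>\<^sup>2)\<close>, which gives a lower bound of the same order.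
\<close>

section \<open>Rotation invariance of the area measure\<close>

text \<open>This is the uniqueness argument for Haar measure. It is applied to multiplication by a
  unimodular number, a linear isometry of the real plane.\<close>

lemma distr_lborel_linear_isometry:
  fixes T :: "'a::euclidean_space \<Rightarrow> 'a"
  assumes "linear T" and norm_T: "\<And>x. norm (T x) = norm x"
  shows "distr lborel borel T = lborel"
proof (rule measure_eqI)
  have "bounded_linear T"
    using \<open>linear T\<close> by (simp add: linear_conv_bounded_linear)
  then have meas [measurable]: "T \<in> borel_measurable borel"
    by (intro borel_measurable_continuous_onI linear_continuous_on)
  show "sets (distr lborel borel T) = sets lborel"
    by simp
  fix A :: "'a set" assume "A \<in> sets (distr lborel borel T)"
  then have [measurable]: "A \<in> sets borel"
    by simp
  define B :: "'a set" where "B = ball 0 1"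
  have [measurable]: "B \<in> sets borel"
    by (simp add: B_def)
  have T_B: "T x \<in> B \<longleftrightarrow> x \<in> B" for x
    by (simp add: B_def norm_T)
  have minus_B: "- x \<in> B \<longleftrightarrow> x \<in> B" for x
    by (simp add: B_def)
  have shift: "(\<integral>\<^sup>+x. g (c + x) \<partial>lborel) = (\<integral>\<^sup>+x. g x \<partial>lborel)"
    if [measurable]: "g \<in> borel_measurable borel" for g :: "'a \<Rightarrow> ennreal" and c
    using nn_integral_distr[of "(+) c" lborel borel g] by (simp add: lborel_distr_plus)
  have T_add: "T (x + y) = T x + T y" for x y
    using \<open>linear T\<close> by (rule linear_add)
  \<comment> \<open>A right inverse of \<open>T\<close> is needed to realize a shift by
    \<open>y\<close> in the image as a shift by \<open>S y\<close> in the argument.\<close>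
  obtain S where "linear S" and TS: "\<And>y. T (S y) = y"
  proof -
    have "inj T"
      using norm_T by (metis \<open>linear T\<close> linear_injective_0 norm_eq_zero)
    then show thesis
      using linear_injective_isomorphism[OF \<open>linear T\<close>] that by blast
  qed
  have [measurable]: "S \<in> borel_measurable borel"
    using \<open>linear S\<close> by (intro borel_measurable_continuous_onI linear_continuous_on)
      (simp add: linear_conv_bounded_linear)
  \<comment> \<open>Both \<open>distr lborel borel T\<close> and \<open>lborel\<close> are translation invariant, so Fubini gives
    proportionality; the ball \<open>B\<close>, on which they agree, fixes the factor.\<close>
  have "emeasure (distr lborel borel T) A * emeasure lborel B
      = (\<integral>\<^sup>+x. indicator A (T x) * (\<integral>\<^sup>+y. indicator B y \<partial>lborel) \<partial>lborel)"
    using nn_integral_distr[of T lborel borel "indicator A"]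
    by (simp add: nn_integral_multc)
  also have "\<dots> = (\<integral>\<^sup>+x. (\<integral>\<^sup>+y. indicator A (T x) * indicator B (y - T x) \<partial>lborel) \<partial>lborel)"
    using shift[of "indicator B" "- T x" for x] by (simp add: nn_integral_cmult)
  also have "\<dots> = (\<integral>\<^sup>+y. (\<integral>\<^sup>+x. indicator A (T x) * indicator B (y - T x) \<partial>lborel) \<partial>lborel)"
    by (rule lborel_pair.Fubini') measurable
  \<comment> \<open>Translating \<open>x\<close> by \<open>S y\<close> turns \<open>T x\<close> into
    \<open>y + T x\<close> and \<open>y - T x\<close> into \<open>- T x\<close>.\<close>
  also have "\<dots> = (\<integral>\<^sup>+y. (\<integral>\<^sup>+x. indicator A (y + T x) * indicator B (- T x) \<partial>lborel) \<partial>lborel)"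
  proof (rule nn_integral_cong)
    fix y
    show "(\<integral>\<^sup>+x. indicator A (T x) * indicator B (y - T x) \<partial>lborel)
       = (\<integral>\<^sup>+x. indicator A (y + T x) * indicator B (- T x) \<partial>(lborel :: 'a measure))"
      using shift[of "\<lambda>x. indicator A (T x) * indicator B (y - T x)" "S y"]
      by (simp add: T_add TS)
  qed
  also have "\<dots> = (\<integral>\<^sup>+x. (\<integral>\<^sup>+y. indicator A (y + T x) * indicator B (- T x) \<partial>lborel) \<partial>lborel)"
    by (rule lborel_pair.Fubini') measurable
  \<comment> \<open>The ball is symmetric and preserved by \<open>T\<close>, so \<open>- T x\<close>
    lies in it exactly when \<open>x\<close> does; translating \<open>y\<close> by
    \<open>T x\<close> decouples the two variables.\<close>
  also have "\<dots> = (\<integral>\<^sup>+x. (\<integral>\<^sup>+y. indicator A y \<partial>lborel) * indicator B x \<partial>lborel)"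
  proof (rule nn_integral_cong)
    fix x
    have "indicator B (- T x) = (indicator B x :: ennreal)"
      by (simp add: indicator_def minus_B T_B)
    then show "(\<integral>\<^sup>+y. indicator A (y + T x) * indicator B (- T x) \<partial>lborel)
        = (\<integral>\<^sup>+y. indicator A y \<partial>lborel) * indicator B x"
      using shift[of "indicator A" "T x"] by (simp add: nn_integral_multc add.commute)
  qed
  also have "\<dots> = emeasure lborel A * emeasure lborel B"
    by (simp add: nn_integral_cmult)
  finally have "emeasure (distr lborel borel T) A * emeasure lborel B
      = emeasure lborel A * emeasure lborel B" .
  moreover have "emeasure lborel B \<noteq> 0" "emeasure lborel B \<noteq> \<infinity>"
    by (simp_all add: B_def emeasure_ball less_imp_neq[OF unit_ball_vol_pos, symmetric])
  ultimately show "emeasure (distr lborel borel T) A = emeasure lborel A"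
    by (simp add: ennreal_mult_cancel_left mult.commute[of _ "emeasure lborel B"])
qed

section \<open>Normalized area on the disc\<close>

lemma emeasure_unit_disc: "emeasure lborel (ball 0 1 :: complex set) = ennreal pi"
  by (simp add: emeasure_ball unit_ball_vol_2)

lemma sets_disc_area [measurable_cong, simp]: "sets disc_area = sets borel"
  and space_disc_area [simp]: "space disc_area = UNIV"
  by (simp_all add: disc_area_def)

lemma nn_integral_disc_area:
  "f \<in> borel_measurable borel \<Longrightarrow>
    (\<integral>\<^sup>+z. f z \<partial>disc_area) = (\<integral>\<^sup>+z. f z * indicator (ball 0 1) z \<partial>lborel) / ennreal pi"
  by (simp add: disc_area_def nn_integral_uniform_measure emeasure_unit_disc)

text \<open>Lebesgue measure and the unit disc are both preserved by a unimodular factor.\<close>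

lemma distr_disc_area_rotation:
  assumes "cmod w = 1"
  shows "distr disc_area borel ((*) w) = disc_area"
proof (rule measure_eqI)
  fix A assume "A \<in> sets (distr disc_area borel ((*) w))"
  then have [measurable]: "A \<in> sets borel"
    by simp
  have "distr lborel borel ((*) w) = lborel"
    using assms by (intro distr_lborel_linear_isometry) (simp_all add: norm_mult linear_times)
  moreover have meas: "(\<lambda>z. indicator A z * indicator (ball 0 1) z :: ennreal) \<in> borel_measurable borel"
    using borel_open[OF open_ball] by measurable
  ultimately have "(\<integral>\<^sup>+z. indicator A z * indicator (ball 0 1) z \<partial>lborel)
      = (\<integral>\<^sup>+z. indicator A (w * z) * indicator (ball 0 1) (w * z) \<partial>lborel)"
    using nn_integral_distr[of "(*) w" lborel borel "\<lambda>z. indicator A z * indicator (ball 0 1) z"]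
    by simp
  also have "\<dots> = (\<integral>\<^sup>+z. indicator A (w * z) * indicator (ball 0 1) z \<partial>lborel)"
    using assms by (simp add: indicator_def norm_mult)
  finally have eq: "(\<integral>\<^sup>+z. indicator A z * indicator (ball 0 1) z \<partial>lborel)
      = (\<integral>\<^sup>+z. indicator A (w * z) * indicator (ball 0 1) z \<partial>lborel)" .
  have "emeasure (distr disc_area borel ((*) w)) A = (\<integral>\<^sup>+z. indicator A (w * z) \<partial>disc_area)"
    using nn_integral_distr[of "(*) w" disc_area borel "indicator A"] by simp
  also have "\<dots> = (\<integral>\<^sup>+z. indicator A z * indicator (ball 0 1) z \<partial>lborel) / ennreal pi"
    unfolding eq by (rule nn_integral_disc_area) measurable
  also have "\<dots> = (\<integral>\<^sup>+z. indicator A z \<partial>disc_area)"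
    by (rule nn_integral_disc_area[symmetric]) measurable
  finally show "emeasure (distr disc_area borel ((*) w)) A = emeasure disc_area A"
    by simp
qed simp

text \<open>A disc of radius \<open>sqrt x\<close> has normalized area \<open>x\<close>, so the
  squared modulus is uniformly distributed. This substitution does the work of polar coordinates for
  radial integrands.\<close>

lemma distr_disc_area_norm_square:
  "distr disc_area borel (\<lambda>z. (cmod z)\<^sup>2) = uniform_measure lborel {0<..<1}"
proof (rule measure_eqI_lessThan)
  fix x :: real
  have meas: "emeasure (distr disc_area borel (\<lambda>z. (cmod z)\<^sup>2)) {x<..}
      = emeasure lborel (ball 0 1 \<inter> {z. x < (cmod z)\<^sup>2}) / ennreal pi"
    by (simp add: emeasure_distr disc_area_def emeasure_unit_disc vimage_def)
  consider "x < 0" | "0 \<le> x" "x < 1" | "1 \<le> x"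
    by linarith
  then have "emeasure (distr disc_area borel (\<lambda>z. (cmod z)\<^sup>2)) {x<..}
      = emeasure (uniform_measure lborel {0<..<1}) {x<..}"
  proof cases
    case 1
    then have "x < (cmod z)\<^sup>2" for z
      by (rule less_le_trans) simp
    then have "ball 0 1 \<inter> {z. x < (cmod z)\<^sup>2} = ball 0 1"
      by auto
    moreover have "{0<..<1} \<inter> {x<..} = {0<..<1}"
      using 1 by auto
    ultimately show ?thesis
      unfolding meas by (simp add: emeasure_unit_disc)
  next
    case 2
    have "x < (cmod z)\<^sup>2 \<longleftrightarrow> sqrt x < cmod z" for z
      using real_sqrt_less_iff[of x "(cmod z)\<^sup>2"]
      by (simp only: real_sqrt_abs abs_norm_cancel)
    then have "ball 0 1 \<inter> {z. x < (cmod z)\<^sup>2} = ball 0 1 - cball 0 (sqrt x)"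
      by (simp only: set_eq_iff Int_iff Diff_iff mem_Collect_eq mem_cball_0 not_le) blast
    moreover have "emeasure lborel (ball 0 1 - cball 0 (sqrt x) :: complex set) = ennreal ((1 - x) * pi)"
    proof -
      have "cball 0 (sqrt x) \<subseteq> (ball 0 1 :: complex set)"
        using 2 by (simp add: cball_subset_ball_iff)
      then show ?thesis
        using 2 by (subst emeasure_Diff)
          (auto simp: emeasure_unit_disc emeasure_cball unit_ball_vol_2 ennreal_minus algebra_simps)
    qed
    moreover have "{0<..<1} \<inter> {x<..} = {x<..<1}"
      using 2 by auto
    ultimately show ?thesis
      unfolding meas using 2 by (simp add: divide_ennreal divide_ennreal[of _ 1, simplified])
  next
    case 3
    have "\<not> x < (cmod z)\<^sup>2" if "cmod z < 1" for z
      using 3 that power_le_one[of "cmod z" 2] by simp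
    then have "ball 0 1 \<inter> {z. x < (cmod z)\<^sup>2} = {}"
      by auto
    moreover have "{0<..<1} \<inter> {x<..} = {}"
      using 3 by auto
    ultimately show ?thesis
      unfolding meas by simp
  qed
  then show eq: "emeasure (distr disc_area borel (\<lambda>z. (cmod z)\<^sup>2)) {x<..}
      = emeasure (uniform_measure lborel {0<..<1}) {x<..}" .
  \<comment> \<open>Equality on upper half lines determines the measure once the values there are
    finite.\<close>
  have "emeasure lborel ({0<..<1} \<inter> {x<..}) \<le> emeasure lborel {0<..<1::real}"
    by (intro emeasure_mono) auto
  then have "emeasure (uniform_measure lborel {0<..<1}) {x<..} \<le> 1"
    by (simp add: divide_ennreal_def)
  then show "emeasure (distr disc_area borel (\<lambda>z. (cmod z)\<^sup>2)) {x<..} < \<infinity>"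
    unfolding eq by (rule le_less_trans) simp
qed simp_all

section \<open>The weighted measure and its moments\<close>

text \<open>The factor \<open>\<alpha> + 1\<close> of the norm is left out, so for
  \<open>\<alpha> > -1\<close> the total mass is \<open>1 / (\<alpha> + 1)\<close>.\<close>

definition bergman_measure :: "real \<Rightarrow> complex measure" where
  "bergman_measure \<alpha> = density disc_area (\<lambda>z. ennreal ((1 - (cmod z)\<^sup>2) powr \<alpha>))"

lemma sets_bergman_measure [measurable_cong, simp]: "sets (bergman_measure \<alpha>) = sets borel"
  and space_bergman_measure [simp]: "space (bergman_measure \<alpha>) = UNIV"
  by (simp_all add: bergman_measure_def)

lemma nn_integral_bergman_measure:
  "f \<in> borel_measurable borel \<Longrightarrow>
    (\<integral>\<^sup>+z. f z \<partial>bergman_measure \<alpha>) = (\<integral>\<^sup>+z. ennreal ((1 - (cmod z)\<^sup>2) powr \<alpha>) * f z \<partial>disc_area)"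
  unfolding bergman_measure_def by (subst nn_integral_density) auto

lemma AE_bergman_measure: "AE z in bergman_measure \<alpha>. cmod z < 1"
proof -
  have "AE z in disc_area. cmod z < 1"
    unfolding disc_area_def by (intro AE_uniform_measureI) auto
  then show ?thesis
    unfolding bergman_measure_def by (subst AE_density) auto
qed

lemma distr_bergman_measure_rotation:
  assumes "cmod w = 1"
  shows "distr (bergman_measure \<alpha>) borel ((*) w) = bergman_measure \<alpha>"
proof (rule measure_eqI)
  fix A assume "A \<in> sets (distr (bergman_measure \<alpha>) borel ((*) w))"
  then have [measurable]: "A \<in> sets borel"
    by simp
  define h where "h z = ennreal ((1 - (cmod z)\<^sup>2) powr \<alpha>) * indicator A z" for z
  have h [measurable]: "h \<in> borel_measurable borel"
    unfolding h_def by measurable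
  have "emeasure (distr (bergman_measure \<alpha>) borel ((*) w)) A
      = (\<integral>\<^sup>+z. indicator A (w * z) \<partial>bergman_measure \<alpha>)"
    using nn_integral_distr[of "(*) w" "bergman_measure \<alpha>" borel "indicator A"] by simp
  also have "\<dots> = (\<integral>\<^sup>+z. h (w * z) \<partial>disc_area)"
    using assms by (subst nn_integral_bergman_measure) (auto simp: h_def norm_mult)
  also have "\<dots> = (\<integral>\<^sup>+z. h z \<partial>disc_area)"
    using nn_integral_distr[of "(*) w" disc_area borel h] distr_disc_area_rotation[OF assms] by simp
  also have "\<dots> = (\<integral>\<^sup>+z. indicator A z \<partial>bergman_measure \<alpha>)"
    by (subst nn_integral_bergman_measure) (auto simp: h_def[abs_def])
  finally show "emeasure (distr (bergman_measure \<alpha>) borel ((*) w)) A = emeasure (bergman_measure \<alpha>) A"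
    by simp
qed simp

text \<open>With \<open>t\<close> the squared modulus, uniform on the unit interval, the moment
  becomes Euler's Beta integral.\<close>

lemma nn_integral_norm_power_bergman_measure:
  assumes "\<alpha> > -1"
  shows "(\<integral>\<^sup>+z. ennreal (cmod z ^ (2 * j)) \<partial>bergman_measure \<alpha>) = ennreal (Beta (real j + 1) (\<alpha> + 1))"
proof -
  define g where "g t = t powr (real j + 1 - 1) * (1 - t) powr (\<alpha> + 1 - 1)" for t :: real
  have [measurable]: "g \<in> borel_measurable borel"
    unfolding g_def by measurable
  \<comment> \<open>The origin has to be excluded: for \<open>j = 0\<close> the factor
    \<open>0 powr 0\<close> in \<open>g\<close> is 0, while \<open>0 ^ 0\<close> is 1.\<close>
  have "AE z in disc_area. ennreal ((1 - (cmod z)\<^sup>2) powr \<alpha>) * ennreal (cmod z ^ (2 * j)) = ennreal (g ((cmod z)\<^sup>2))"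
  proof -
    have "AE z in lborel. z \<noteq> (0::complex)"
      by (rule AE_lborel_singleton)
    then have "AE z in disc_area. z \<noteq> 0"
      unfolding disc_area_def by (intro AE_uniform_measureI) auto
    moreover have "ennreal ((1 - (cmod z)\<^sup>2) powr \<alpha>) * ennreal (cmod z ^ (2 * j)) = ennreal (g ((cmod z)\<^sup>2))"
      if "z \<noteq> 0" for z
    proof -
      have "g ((cmod z)\<^sup>2) = (1 - (cmod z)\<^sup>2) powr \<alpha> * ((cmod z)\<^sup>2) ^ j"
        using that by (simp add: g_def powr_realpow)
      then show ?thesis
        by (simp only: power_mult ennreal_mult' powr_ge_zero)
    qed
    ultimately show ?thesis
      by (rule eventually_mono)
  qed
  then have "(\<integral>\<^sup>+z. ennreal (cmod z ^ (2 * j)) \<partial>bergman_measure \<alpha>)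
      = (\<integral>\<^sup>+z. ennreal (g ((cmod z)\<^sup>2)) \<partial>disc_area)"
    by (subst nn_integral_bergman_measure) (auto intro: nn_integral_cong_AE)
  also have "\<dots> = (\<integral>\<^sup>+t. ennreal (g t) \<partial>uniform_measure lborel {0<..<1})"
    using nn_integral_distr[of "\<lambda>z. (cmod z)\<^sup>2" disc_area borel "\<lambda>t. ennreal (g t)"]
    by (simp add: distr_disc_area_norm_square)
  also have "\<dots> = (\<integral>\<^sup>+t. ennreal (g t) * indicator {0<..<1} t \<partial>lborel)"
    by (subst nn_integral_uniform_measure) (auto simp: divide_ennreal_def)
  also have "\<dots> = ennreal (Beta (real j + 1) (\<alpha> + 1))"
  proof (rule nn_integral_has_integral_lebesgue')
    show "(g has_integral Beta (real j + 1) (\<alpha> + 1)) {0<..<1}"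
      using has_integral_Beta_real[of "real j + 1" "\<alpha> + 1"] assms
      unfolding g_def by (simp add: has_integral_Icc_iff_Ioo)
  qed (simp add: g_def)
  finally show ?thesis .
qed

lemma finite_measure_bergman_measure:
  assumes "\<alpha> > -1"
  shows "finite_measure (bergman_measure \<alpha>)"
  using nn_integral_norm_power_bergman_measure[OF assms, of 0]
  by (intro finite_measureI) simp

lemma Beta_real_nonneg: "a > 0 \<Longrightarrow> b > 0 \<Longrightarrow> Beta a b \<ge> (0::real)"
  by (simp add: Beta_def)

text \<open>Off the diagonal, rotation invariance makes the integral equal to its own negative for a
  suitable rotation; on the diagonal the integrand is radial and the Beta moment applies.\<close>

lemma integral_monomials_bergman_measure:
  assumes "\<alpha> > -1"
  shows "integrable (bergman_measure \<alpha>) (\<lambda>z. z ^ j * cnj z ^ k)"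
    and "(LINT z|bergman_measure \<alpha>. z ^ j * cnj z ^ k)
      = (if j = k then of_real (Beta (real j + 1) (\<alpha> + 1)) else 0)"
proof -
  interpret finite_measure "bergman_measure \<alpha>"
    by (rule finite_measure_bergman_measure) fact
  have [measurable]: "(\<lambda>z. z ^ j * cnj z ^ k) \<in> borel_measurable borel"
    by (intro borel_measurable_continuous_onI continuous_intros)
  show "integrable (bergman_measure \<alpha>) (\<lambda>z. z ^ j * cnj z ^ k)"
  proof (rule integrable_const_bound[where B = 1])
    have *: "cmod (z ^ j * cnj z ^ k) \<le> 1" if "cmod z < 1" for z
      using that by (auto simp: norm_mult norm_power intro!: mult_le_one power_le_one)
    show "AE z in bergman_measure \<alpha>. norm (z ^ j * cnj z ^ k) \<le> 1"
      using AE_bergman_measure by eventually_elim (rule *)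
  qed measurable
  show "(LINT z|bergman_measure \<alpha>. z ^ j * cnj z ^ k)
      = (if j = k then of_real (Beta (real j + 1) (\<alpha> + 1)) else 0)"
  proof (cases "j = k")
    case True
    have "z ^ j * cnj z ^ j = complex_of_real (cmod z ^ (2 * j))" for z
      by (simp add: power_mult flip: power_mult_distrib) (simp flip: complex_norm_square)
    moreover have "(LINT z|bergman_measure \<alpha>. cmod z ^ (2 * j)) = Beta (real j + 1) (\<alpha> + 1)"
      by (subst integral_eq_nn_integral)
         (use assms in \<open>auto simp: nn_integral_norm_power_bergman_measure Beta_real_nonneg\<close>)
    ultimately show ?thesis
      using True integral_complex_of_real[of "bergman_measure \<alpha>" "\<lambda>z. cmod z ^ (2 * j)"] by simp
  next
    case False
    \<comment> \<open>Rotation by \<open>w\<close> multiplies the integrand by \<open>-1\<close>.\<close>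
    define w where "w = cis (pi / (real j - real k))"
    define I where "I = (LINT z|bergman_measure \<alpha>. z ^ j * cnj z ^ k)"
    have "cmod w = 1"
      by (simp add: w_def)
    have "I = (LINT z|distr (bergman_measure \<alpha>) borel ((*) w). z ^ j * cnj z ^ k)"
      unfolding I_def distr_bergman_measure_rotation[OF \<open>cmod w = 1\<close>] ..
    also have "\<dots> = (LINT z|bergman_measure \<alpha>. (w ^ j * cnj w ^ k) * (z ^ j * cnj z ^ k))"
      by (subst integral_distr) (auto simp: power_mult_distrib mult_ac)
    also have "\<dots> = (w ^ j * cnj w ^ k) * I"
      by (simp add: I_def)
    finally have "I = (w ^ j * cnj w ^ k) * I" .
    moreover have "w ^ j * cnj w ^ k = cis ((real j - real k) * (pi / (real j - real k)))"
      unfolding w_def cis_cnj Complex.DeMoivre cis_mult by (simp add: left_diff_distrib diff_divide_distrib)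
    moreover have "\<dots> = -1"
      using False by simp
    ultimately have "I = 0"
      by simp
    then show ?thesis
      using False by (simp add: I_def)
  qed
qed

section \<open>Parseval identity\<close>

text \<open>Expanding the square gives a double sum of mixed moments, of which orthogonality keeps
  the diagonal.\<close>

lemma integral_polynomial_bergman_measure:
  fixes c :: "nat \<Rightarrow> complex"
  assumes "\<alpha> > -1"
  shows "integrable (bergman_measure \<alpha>) (\<lambda>z. (cmod (\<Sum>j\<in>A. c j * z ^ j))\<^sup>2)"
    and "(LINT z|bergman_measure \<alpha>. (cmod (\<Sum>j\<in>A. c j * z ^ j))\<^sup>2)
      = (\<Sum>j\<in>A. (cmod (c j))\<^sup>2 * Beta (real j + 1) (\<alpha> + 1))"
proof -
  have expand: "complex_of_real ((cmod (\<Sum>j\<in>A. c j * z ^ j))\<^sup>2)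
      = (\<Sum>j\<in>A. \<Sum>k\<in>A. c j * cnj (c k) * (z ^ j * cnj z ^ k))" for z
    unfolding complex_norm_square by (simp add: sum_product mult_ac)
  note int = integral_monomials_bergman_measure[OF assms]
  have "integrable (bergman_measure \<alpha>) (\<lambda>z. complex_of_real ((cmod (\<Sum>j\<in>A. c j * z ^ j))\<^sup>2))"
    unfolding expand by (intro Bochner_Integration.integrable_sum integrable_mult_right int)
  then show "integrable (bergman_measure \<alpha>) (\<lambda>z. (cmod (\<Sum>j\<in>A. c j * z ^ j))\<^sup>2)"
    by (simp only: complex_of_real_integrable_eq)
  have "complex_of_real (LINT z|bergman_measure \<alpha>. (cmod (\<Sum>j\<in>A. c j * z ^ j))\<^sup>2)
      = (LINT z|bergman_measure \<alpha>. (\<Sum>j\<in>A. \<Sum>k\<in>A. c j * cnj (c k) * (z ^ j * cnj z ^ k)))"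
    unfolding expand[symmetric] by (rule integral_complex_of_real[symmetric])
  also have "\<dots> = (\<Sum>j\<in>A. \<Sum>k\<in>A. c j * cnj (c k) *
      (if j = k then of_real (Beta (real j + 1) (\<alpha> + 1)) else 0))"
    by (subst Bochner_Integration.integral_sum Bochner_Integration.integrable_sum,
        (intro Bochner_Integration.integrable_sum integrable_mult_right int)?)+
       (simp add: int)
  also have "\<dots> = of_real (\<Sum>j\<in>A. (cmod (c j))\<^sup>2 * Beta (real j + 1) (\<alpha> + 1))"
    \<comment> \<open>For infinite \<open>A\<close> both sums are 0 by convention.\<close>
    by (cases "finite A") (simp_all add: if_distrib complex_norm_square[symmetric] cong: if_cong)
  finally show "(LINT z|bergman_measure \<alpha>. (cmod (\<Sum>j\<in>A. c j * z ^ j))\<^sup>2)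
      = (\<Sum>j\<in>A. (cmod (c j))\<^sup>2 * Beta (real j + 1) (\<alpha> + 1))"
    by (simp only: of_real_eq_iff)
qed

text \<open>This is the triangle inequality combined with Young's inequality. It permits comparing
  squared norms with a factor arbitrarily close to 1 on the main term.\<close>

lemma norm_square_le_weighted:
  fixes x y :: "'a::real_normed_vector"
  assumes "\<epsilon> > 0"
  shows "(norm x)\<^sup>2 \<le> (1 + \<epsilon>) * (norm y)\<^sup>2 + (1 + 1 / \<epsilon>) * (norm (y - x))\<^sup>2"
proof -
  define a b where "a = norm y" and "b = norm (y - x)"
  have "norm x \<le> a + b"
    unfolding a_def b_def by (metis norm_triangle_sub norm_minus_commute)
  then have "(norm x)\<^sup>2 \<le> (a + b)\<^sup>2"
    by (intro power_mono) auto
  \<comment> \<open>The added square cancels the mixed term \<open>2 * a * b\<close>.\<close>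
  also have "\<dots> \<le> (a + b)\<^sup>2 + (\<epsilon> * a - b)\<^sup>2 / \<epsilon>"
    using assms by simp
  also have "\<dots> = (1 + \<epsilon>) * a\<^sup>2 + (1 + 1 / \<epsilon>) * b\<^sup>2"
    using assms by (simp add: field_simps power2_eq_square)
  finally show ?thesis
    by (simp add: a_def b_def)
qed

text \<open>Fatou's lemma bounds the squared norm of each remainder by the tail \<open>T L\<close>,
  which gives integrability and one inequality. The other follows from the polynomial case by
  comparing \<open>f\<close> with its partial sums, first letting \<open>L\<close> tend to infinity
  and then \<epsilon> to 0.\<close>

theorem parseval_bergman_measure:
  fixes c :: "nat \<Rightarrow> complex"
  assumes "\<alpha> > -1" and f [measurable]: "f \<in> borel_measurable borel"
    and sums: "\<And>z. cmod z < 1 \<Longrightarrow> (\<lambda>j. c j * z ^ j) sums f z"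
    and summable: "summable (\<lambda>j. (cmod (c j))\<^sup>2 * Beta (real j + 1) (\<alpha> + 1))"
  shows "(LINT z|bergman_measure \<alpha>. (cmod (f z))\<^sup>2)
      = (\<Sum>j. (cmod (c j))\<^sup>2 * Beta (real j + 1) (\<alpha> + 1))"
proof -
  define b where "b j = (cmod (c j))\<^sup>2 * Beta (real j + 1) (\<alpha> + 1)" for j
  define S where "S L z = (\<Sum>j<L. c j * z ^ j)" for L z
  define T where "T L = suminf b - sum b {..<L}" for L
  define M where "M = bergman_measure \<alpha>"
  define X where "X = (LINT z|M. (cmod (f z))\<^sup>2)"
  have sets_M [measurable_cong]: "sets M = sets borel"
    by (simp add: M_def)
  have [measurable]: "S L \<in> borel_measurable borel" for L
    unfolding S_def by measurable
  have b_nonneg: "b j \<ge> 0" for j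
    using assms(1) by (simp add: b_def Beta_real_nonneg)
  have "summable b"
    using summable by (simp add: b_def[abs_def])
  then have T_ge: "sum b {L..<L + K} \<le> T L" for L K
  proof -
    have "sum b {..<L + K} \<le> suminf b"
      using \<open>summable b\<close> b_nonneg by (intro sum_le_suminf) auto
    moreover have "sum b {..<L + K} = sum b {..<L} + sum b {L..<L + K}"
      by (simp add: sum.atLeastLessThan_concat lessThan_atLeast0)
    ultimately show ?thesis
      by (simp add: T_def)
  qed
  then have T_nonneg: "T L \<ge> 0" for L
    by (metis order_trans sum_nonneg b_nonneg)
  have fatou: "(\<integral>\<^sup>+z. ennreal ((cmod (f z - S L z))\<^sup>2) \<partial>M) \<le> ennreal (T L)" for L
  proof -
    \<comment> \<open>The finite blocks converge pointwise to the remainder \<open>f - S L\<close>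
      on the disc, and their integrals are known exactly.\<close>
    define u where "u K z = ennreal ((cmod (\<Sum>j\<in>{L..<L + K}. c j * z ^ j))\<^sup>2)" for K z
    have [measurable]: "u K \<in> borel_measurable borel" for K
      unfolding u_def by measurable
    have liminf: "ennreal ((cmod (f z - S L z))\<^sup>2) = liminf (\<lambda>K. u K z)" if "cmod z < 1" for z
    proof -
      have "(\<lambda>K. S (L + K) z) \<longlonglongrightarrow> f z"
        using LIMSEQ_ignore_initial_segment[OF sums[OF that, unfolded sums_def], of L]
        by (simp add: S_def add.commute)
      then have "(\<lambda>K. ennreal ((cmod (S (L + K) z - S L z))\<^sup>2)) \<longlonglongrightarrow> ennreal ((cmod (f z - S L z))\<^sup>2)"
        by (intro tendsto_intros)
      moreover have "S (L + K) z - S L z = (\<Sum>j\<in>{L..<L + K}. c j * z ^ j)" for K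
        unfolding S_def lessThan_atLeast0 by (subst sum_diff_nat_ivl) auto
      ultimately have "(\<lambda>K. u K z) \<longlonglongrightarrow> ennreal ((cmod (f z - S L z))\<^sup>2)"
        by (simp add: u_def)
      then show ?thesis
        by (intro lim_imp_Liminf[symmetric]) auto
    qed
    have "AE z in M. ennreal ((cmod (f z - S L z))\<^sup>2) = liminf (\<lambda>K. u K z)"
      using AE_bergman_measure[of \<alpha>] unfolding M_def by eventually_elim (rule liminf)
    then have "(\<integral>\<^sup>+z. ennreal ((cmod (f z - S L z))\<^sup>2) \<partial>M) = (\<integral>\<^sup>+z. liminf (\<lambda>K. u K z) \<partial>M)"
      by (rule nn_integral_cong_AE)
    also have "\<dots> \<le> liminf (\<lambda>K. \<integral>\<^sup>+z. u K z \<partial>M)"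
      by (rule nn_integral_liminf) measurable
    also have "(\<lambda>K. \<integral>\<^sup>+z. u K z \<partial>M) = (\<lambda>K. ennreal (sum b {L..<L + K}))"
      using integral_polynomial_bergman_measure[OF assms(1), of c]
      by (simp add: u_def M_def b_def nn_integral_eq_integral)
    also have "liminf \<dots> \<le> liminf (\<lambda>K::nat. ennreal (T L))"
      using T_ge by (intro Liminf_mono always_eventually allI ennreal_leI) auto
    also have "\<dots> = ennreal (T L)"
      by (rule Liminf_const) simp
    finally show ?thesis .
  qed
  have integrable: "integrable M (\<lambda>z. (cmod (f z - S L z))\<^sup>2)" for L
    using fatou[of L] by (intro integrableI_nonneg) (auto simp: le_less_trans)
  have fatou': "(LINT z|M. (cmod (f z - S L z))\<^sup>2) \<le> T L" for L
    using fatou[of L] T_nonneg by (simp add: nn_integral_eq_integral[OF integrable])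
  have int_f: "integrable M (\<lambda>z. (cmod (f z))\<^sup>2)"
    using integrable[of 0] by (simp add: S_def)
  \<comment> \<open>For \<open>L = 0\<close> the partial sum is 0 and the tail is the whole
    series.\<close>
  have "X \<le> suminf b"
    using fatou'[of 0] by (simp add: S_def X_def T_def)
  moreover have "suminf b \<le> X"
  proof -
    have bound: "suminf b \<le> (1 + \<epsilon>) * X" if "\<epsilon> > 0" for \<epsilon>
    proof (rule LIMSEQ_le)
      show "(\<lambda>L. sum b {..<L}) \<longlonglongrightarrow> suminf b"
        using \<open>summable b\<close> by (rule summable_LIMSEQ)
      \<comment> \<open>The coefficient \<open>1 + 1 / \<epsilon>\<close> may be large, but
        \<epsilon> is fixed while the tail tends to 0.\<close>
      have "(\<lambda>L. (1 + \<epsilon>) * X + (1 + 1 / \<epsilon>) * T L)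
          \<longlonglongrightarrow> (1 + \<epsilon>) * X + (1 + 1 / \<epsilon>) * (suminf b - suminf b)"
        unfolding T_def by (intro tendsto_intros summable_LIMSEQ \<open>summable b\<close>)
      then show "(\<lambda>L. (1 + \<epsilon>) * X + (1 + 1 / \<epsilon>) * T L) \<longlonglongrightarrow> (1 + \<epsilon>) * X"
        by simp
      have "sum b {..<L} \<le> (1 + \<epsilon>) * X + (1 + 1 / \<epsilon>) * T L" for L
      proof -
        have "sum b {..<L} = (LINT z|M. (cmod (S L z))\<^sup>2)"
          using integral_polynomial_bergman_measure(2)[OF assms(1), of c]
          by (simp add: b_def M_def S_def)
        also have "\<dots> \<le> (LINT z|M. (1 + \<epsilon>) * (cmod (f z))\<^sup>2 + (1 + 1 / \<epsilon>) * (cmod (f z - S L z))\<^sup>2)"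
          using norm_square_le_weighted[OF that] integral_polynomial_bergman_measure(1)[OF assms(1), of c]
          by (intro integral_mono Bochner_Integration.integrable_add integrable_mult_right int_f integrable)
             (auto simp: S_def M_def)
        also have "\<dots> = (1 + \<epsilon>) * X + (1 + 1 / \<epsilon>) * (LINT z|M. (cmod (f z - S L z))\<^sup>2)"
          by (simp add: X_def int_f integrable)
        also have "\<dots> \<le> (1 + \<epsilon>) * X + (1 + 1 / \<epsilon>) * T L"
          using that fatou' by (intro add_left_mono mult_left_mono) auto
        finally show ?thesis .
      qed
      then show "\<exists>N. \<forall>L\<ge>N. sum b {..<L} \<le> (1 + \<epsilon>) * X + (1 + 1 / \<epsilon>) * T L"
        by blast
    qed
    show ?thesis
    proof (rule tendsto_lowerbound)
      have "((\<lambda>\<epsilon>. (1 + \<epsilon>) * X) \<longlongrightarrow> (1 + 0) * X) (at_right 0)"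
        by (intro tendsto_intros)
      then show "((\<lambda>\<epsilon>. (1 + \<epsilon>) * X) \<longlongrightarrow> X) (at_right 0)"
        by simp
      show "\<forall>\<^sub>F \<epsilon> in at_right 0. suminf b \<le> (1 + \<epsilon>) * X"
        using bound by (auto simp: eventually_at_right_less intro: eventually_mono[OF eventually_at_right_less])
    qed simp
  qed
  ultimately show ?thesis
    by (simp add: X_def M_def b_def[abs_def])
qed

section \<open>Taylor coefficients and their weights\<close>

text \<open>This is the binomial series with exponent \<open>- N\<close> at \<open>- x\<close>:
  negating the upper index yields ordinary binomial coefficients and a sign that cancels the one in
  \<open>(- x) ^ j\<close>.\<close>

lemma sums_inverse_one_minus_power:
  fixes x :: complex
  assumes "cmod x < 1" and "N \<ge> 1"
  shows "(\<lambda>j. of_nat ((j + N - 1) choose (N - 1)) * x ^ j) sums (1 / (1 - x) ^ N)"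
proof -
  have "((- of_nat N) gchoose j) * (- x) ^ j = of_nat ((j + N - 1) choose (N - 1)) * x ^ j" for j
  proof -
    have "(of_nat N + of_nat j - 1 :: complex) = of_nat (j + N - 1)"
      using assms(2) by (simp add: of_nat_diff)
    then have "((- of_nat N :: complex) gchoose j) = (- 1) ^ j * of_nat ((j + N - 1) choose j)"
      by (simp add: gbinomial_minus binomial_gbinomial)
    moreover have "(j + N - 1) choose j = (j + N - 1) choose (N - 1)"
      using binomial_symmetric[of j "j + N - 1"] assms(2) by simp
    moreover have "(- 1) ^ j * (- x) ^ j = x ^ j"
      by (simp flip: power_mult_distrib)
    ultimately show ?thesis
      by (simp add: mult_ac)
  qed
  moreover have "(1 + - x) powr (- of_nat N) = 1 / (1 - x) ^ N"
    using assms by (auto simp: powr_minus powr_nat' divide_inverse)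
  ultimately show ?thesis
    using gen_binomial_complex[of "- x" "- of_nat N"] assms(1) by simp
qed

text \<open>Since \<open>cnj a\<close> is the inverse of \<open>a\<close>, factoring
  \<open>- a\<close> out of \<open>z - a\<close> reduces a pole at \<open>a\<close> to a pole at
  1.\<close>

lemma sums_inverse_power_unit_pole:
  fixes a z :: complex
  assumes "cmod a = 1" and "cmod z < 1" and "N \<ge> 1"
  shows "(\<lambda>j. (- 1) ^ N * of_nat ((j + N - 1) choose (N - 1)) * cnj a ^ (j + N) * z ^ j)
           sums (1 / (z - a) ^ N)"
proof -
  have a: "a * cnj a = 1"
    using assms(1) by (simp add: complex_norm_square[symmetric])
  then have pole: "z - a = - a * (1 - cnj a * z)"
    by (simp add: algebra_simps)
  have inv: "1 / (- a) ^ N = (- 1) ^ N * cnj a ^ N"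
  proof -
    have "(- a) ^ N * ((- 1) ^ N * cnj a ^ N) = 1"
      by (simp add: a flip: power_mult_distrib)
    then show ?thesis
      by (metis div_by_1 divide_eq_eq mult.commute mult_zero_left nonzero_mult_div_cancel_left one_neq_zero)
  qed
  have eq: "1 / (z - a) ^ N = (- 1) ^ N * cnj a ^ N * (1 / (1 - cnj a * z) ^ N)"
    unfolding pole inv[symmetric] power_mult_distrib by (simp only: times_divide_times_eq mult_1_right)
  have "cmod (cnj a * z) < 1"
    using assms by (simp add: norm_mult)
  from sums_mult[OF sums_inverse_one_minus_power[OF this assms(3)], of "(- 1) ^ N * cnj a ^ N"]
  show ?thesis
    unfolding eq by (simp add: power_mult_distrib power_add mult_ac)
qed

text \<open>On the unit circle conjugation is inversion, so these are the power sums with exponent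
  \<open>- m\<close>, as produced by expanding the poles about 0.\<close>

definition power_sum :: "nat \<Rightarrow> (nat \<Rightarrow> complex) \<Rightarrow> nat \<Rightarrow> complex" where
  "power_sum n a m = (\<Sum>k<n. cnj (a k) ^ m)"

text \<open>The square of the Taylor coefficient of \<open>1 / (1 - x) ^ N\<close> times the squared
  norm of the monomial of degree \<open>j\<close> in \<open>bergman_measure\<close>.\<close>

definition coeff_weight :: "nat \<Rightarrow> real \<Rightarrow> nat \<Rightarrow> real" where
  "coeff_weight N \<alpha> j = (real ((j + N - 1) choose (N - 1)))\<^sup>2 * Beta (real j + 1) (\<alpha> + 1)"

section \<open>Power-law size of the weights\<close>

text \<open>Both \<open>q\<close> and its reciprocal converge, hence are bounded. This turns an
  asymptotic statement into bounds valid for every index.\<close>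

lemma convergent_positive_bounds:
  fixes q :: "nat \<Rightarrow> real"
  assumes "q \<longlonglongrightarrow> l" and "l > 0" and pos: "\<And>j. q j > 0"
  shows "\<exists>c>0. \<exists>C>0. \<forall>j. c \<le> q j \<and> q j \<le> C"
proof -
  have "Bseq q" "Bseq (\<lambda>j. inverse (q j))"
    using assms by (auto intro!: convergent_imp_Bseq convergentI tendsto_inverse)
  then obtain C D where "C > 0" "\<And>j. \<bar>q j\<bar> \<le> C" "D > 0" "\<And>j. \<bar>inverse (q j)\<bar> \<le> D"
    by (auto simp: Bseq_def)
  then have "inverse D \<le> q j \<and> q j \<le> C" for j
    using pos[of j] by (metis abs_of_pos inverse_inverse_eq inverse_positive_iff_positive le_imp_inverse_le)
  then show ?thesis
    using \<open>C > 0\<close> \<open>D > 0\<close> by (metis inverse_positive_iff_positive)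
qed

text \<open>The quotient of the Beta value by the claimed power is a term of a product formula for
  the Gamma function, with positive limit \<open>Gamma s\<close>.\<close>

lemma Beta_real_asymptotic_bounds:
  fixes s :: real
  assumes "s > 0"
  shows "\<exists>c>0. \<exists>C>0. \<forall>j. c * (real j + 1) powr (- s) \<le> Beta (real j + 1) s
           \<and> Beta (real j + 1) s \<le> C * (real j + 1) powr (- s)"
proof -
  \<comment> \<open>The index \<open>Suc j\<close> makes the base of the power \<open>j + 1\<close>
    and the factorial \<open>fact j\<close>, which is \<open>Gamma (real j + 1)\<close>.\<close>
  have series: "Gamma_series' s (Suc j) = (real j + 1) powr s * Beta (real j + 1) s" for j
  proof -
    have "s \<notin> \<int>\<^sub>\<le>\<^sub>0"
      using assms by (auto elim!: nonpos_Ints_cases)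
    then have "pochhammer s (Suc j) = Gamma (real j + 1 + s) / Gamma s"
      by (subst pochhammer_Gamma) (auto simp: algebra_simps)
    moreover have "Gamma (real j + 1) = fact j"
      using Gamma_fact[of j, where ?'a = real] by (simp add: add.commute)
    ultimately show ?thesis
      by (simp add: Gamma_series'_def Beta_def powr_def add.commute)
  qed
  have "(\<lambda>j. Gamma_series' s (Suc j)) \<longlonglongrightarrow> Gamma s"
    using Gamma_series'_LIMSEQ by (rule LIMSEQ_Suc)
  then obtain c C where "c > 0" "C > 0"
    and bounds: "\<And>j. c \<le> (real j + 1) powr s * Beta (real j + 1) s"
      "\<And>j. (real j + 1) powr s * Beta (real j + 1) s \<le> C"
    unfolding series using convergent_positive_bounds[of _ "Gamma s"] assms
    by (fastforce simp: Beta_def)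
  have "c * (real j + 1) powr (- s) \<le> Beta (real j + 1) s
      \<and> Beta (real j + 1) s \<le> C * (real j + 1) powr (- s)" for j
    using bounds[of j] by (simp add: powr_minus field_simps)
  then show ?thesis
    using \<open>c > 0\<close> \<open>C > 0\<close> by blast
qed

text \<open>The bound \<open>(m / N) ^ N \<le> m choose N\<close> with \<open>m = j + N\<close> is
  divided by \<open>m / N\<close> on both sides, using the absorption identity for
  binomials.\<close>

lemma binomial_ge_power:
  assumes "N \<ge> 1"
  shows "(real (j + N) / real N) ^ (N - 1) \<le> real ((j + N - 1) choose (N - 1))"
proof -
  obtain p where N: "N = Suc p"
    using assms by (cases N) auto
  have "(real (j + N) / real N) ^ N \<le> real ((j + N) choose N)"
    by (rule binomial_ge_n_over_k_pow_k) simp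
  also have "\<dots> = real (j + N) / real N * real ((j + N - 1) choose (N - 1))"
    using Suc_times_binomial_eq[of "j + p" p] by (simp add: N field_simps flip: of_nat_mult)
  finally have "real (j + N) / real N * (real (j + N) / real N) ^ (N - 1)
      \<le> real (j + N) / real N * real ((j + N - 1) choose (N - 1))"
    unfolding N by simp
  then show ?thesis
    by (rule mult_left_le_imp_le) (simp add: N)
qed

text \<open>The binomial grows like a power \<open>N - 1\<close> and the Beta factor decays like a
  power \<open>\<alpha> + 1\<close>, so the exponent is \<open>2 * (N - 1) - (\<alpha> + 1)\<close>.
  The base is \<open>j + N\<close> because that is the index of the accompanying power sum; it is
  compared with \<open>j + 1\<close> through
  \<open>(j + N) / N \<le> j + 1 \<le> j + N\<close>.\<close>

lemma coeff_weight_bounds: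
  assumes "N \<ge> 1" and "\<alpha> > -1"
  shows "\<exists>c>0. \<exists>C>0. \<forall>j. c * real (j + N) powr (2 * real N - 3 - \<alpha>) \<le> coeff_weight N \<alpha> j
           \<and> coeff_weight N \<alpha> j \<le> C * real (j + N) powr (2 * real N - 3 - \<alpha>)"
proof -
  obtain c C where "c > 0" "C > 0"
    and c: "\<And>j. c * (real j + 1) powr (- (\<alpha> + 1)) \<le> Beta (real j + 1) (\<alpha> + 1)"
    and C: "\<And>j. Beta (real j + 1) (\<alpha> + 1) \<le> C * (real j + 1) powr (- (\<alpha> + 1))"
    using Beta_real_asymptotic_bounds[of "\<alpha> + 1"] assms(2) by fastforce
  have split: "real (j + N) powr (2 * real N - 3 - \<alpha>)
      = (real (j + N) ^ (N - 1))\<^sup>2 * real (j + N) powr (- (\<alpha> + 1))" for j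
  proof -
    have "(real (j + N) ^ (N - 1))\<^sup>2 = real (j + N) powr (2 * (real N - 1))"
      using assms(1) powr_realpow[of "real (j + N)" "(N - 1) * 2"]
      by (simp add: of_nat_diff mult.commute flip: power_mult)
    moreover have "2 * real N - 3 - \<alpha> = 2 * (real N - 1) + (- (\<alpha> + 1))"
      by simp
    ultimately show ?thesis
      by (simp only: powr_add)
  qed
  have "c / (real N ^ (N - 1))\<^sup>2 * real (j + N) powr (2 * real N - 3 - \<alpha>) \<le> coeff_weight N \<alpha> j" for j
  proof -
    have "((real (j + N) / real N) ^ (N - 1))\<^sup>2 * (c * real (j + N) powr (- (\<alpha> + 1)))
        \<le> coeff_weight N \<alpha> j"
      unfolding coeff_weight_def
    proof (rule mult_mono)
      show "((real (j + N) / real N) ^ (N - 1))\<^sup>2 \<le> (real ((j + N - 1) choose (N - 1)))\<^sup>2"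
        using binomial_ge_power[OF assms(1)] by (intro power_mono) auto
      have "real (j + N) powr (- (\<alpha> + 1)) \<le> (real j + 1) powr (- (\<alpha> + 1))"
        using assms by (intro powr_mono2') auto
      then show "c * real (j + N) powr (- (\<alpha> + 1)) \<le> Beta (real j + 1) (\<alpha> + 1)"
        using c[of j] \<open>c > 0\<close> by (meson mult_left_mono less_imp_le order_trans)
    qed (use \<open>c > 0\<close> in auto)
    then show ?thesis
      unfolding split by (simp add: power_divide mult_ac)
  qed
  moreover have "coeff_weight N \<alpha> j
      \<le> C * real N powr (\<alpha> + 1) * real (j + N) powr (2 * real N - 3 - \<alpha>)" for j
  proof -
    have "coeff_weight N \<alpha> j \<le> (real (j + N) ^ (N - 1))\<^sup>2
        * (C * (real (j + N) / real N) powr (- (\<alpha> + 1)))"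
      unfolding coeff_weight_def
    proof (rule mult_mono)
      have "(j + N - 1) choose (N - 1) \<le> (j + N - 1) ^ (N - 1)"
        by (rule binomial_le_pow) simp
      also have "\<dots> \<le> (j + N) ^ (N - 1)"
        by (intro power_mono) auto
      finally have "real ((j + N - 1) choose (N - 1)) \<le> real (j + N) ^ (N - 1)"
        by (metis of_nat_mono of_nat_power)
      then show "(real ((j + N - 1) choose (N - 1)))\<^sup>2 \<le> (real (j + N) ^ (N - 1))\<^sup>2"
        by (intro power_mono) auto
      \<comment> \<open>The exponent of the Beta bound is negative, so an upper bound needs a lower
        bound on \<open>j + 1\<close>.\<close>
      have "real (j + N) / real N \<le> real j + 1"
      proof -
        have "real j * 1 \<le> real j * real N"
          using assms(1) by (intro mult_left_mono) auto
        then show ?thesis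
          using assms(1) by (simp add: field_simps)
      qed
      then have "(real j + 1) powr (- (\<alpha> + 1)) \<le> (real (j + N) / real N) powr (- (\<alpha> + 1))"
        using assms by (intro powr_mono2') auto
      then show "Beta (real j + 1) (\<alpha> + 1) \<le> C * (real (j + N) / real N) powr (- (\<alpha> + 1))"
        using C[of j] \<open>C > 0\<close> by (meson mult_left_mono less_imp_le order_trans)
    qed (use assms in \<open>auto intro: Beta_real_nonneg\<close>)
    also have "(real (j + N) / real N) powr (- (\<alpha> + 1))
        = real N powr (\<alpha> + 1) * real (j + N) powr (- (\<alpha> + 1))"
      by (simp only: powr_divide powr_minus) (simp add: field_simps)
    finally show ?thesis
      unfolding split by (simp add: mult_ac)
  qed
  moreover have "c / (real N ^ (N - 1))\<^sup>2 > 0" "C * real N powr (\<alpha> + 1) > 0"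
    using \<open>c > 0\<close> \<open>C > 0\<close> assms(1) by auto
  ultimately show ?thesis
    by blast
qed

section \<open>Power sums of points on the unit circle\<close>

text \<open>In the natural numbers \<open>max t u - min t u\<close> is the distance of
  \<open>t\<close> and \<open>u\<close>. A positive distance from \<open>t\<close> is attained at
  most once on each side, distance 0 only at \<open>t\<close> itself.\<close>

lemma sum_distance_le:
  fixes g :: "nat \<Rightarrow> real"
  assumes "\<And>m. g m \<ge> 0" and "t < M"
  shows "(\<Sum>u<M. g (max t u - min t u)) \<le> g 0 + 2 * (\<Sum>m\<in>{1..<M}. g m)"
proof -
  have "{..<M} = insert t ({..<t} \<union> {t<..<M})" "{..<t} \<inter> {t<..<M} = {}"
    using assms(2) by auto
  then have "(\<Sum>u<M. g (max t u - min t u))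
      = (\<Sum>u<t. g (max t u - min t u)) + g 0 + (\<Sum>u\<in>{t<..<M}. g (max t u - min t u))"
    by (simp add: sum.union_disjoint)
  moreover have "(\<Sum>u<t. g (max t u - min t u)) \<le> (\<Sum>m\<in>{1..<M}. g m)"
  proof -
    have "(\<Sum>u<t. g (max t u - min t u)) = sum g ((\<lambda>u. t - u) ` {..<t})"
      by (subst sum.reindex) (auto simp: inj_on_def)
    also have "\<dots> \<le> sum g {1..<M}"
      using assms by (intro sum_mono2) auto
    finally show ?thesis .
  qed
  moreover have "(\<Sum>u\<in>{t<..<M}. g (max t u - min t u)) \<le> (\<Sum>m\<in>{1..<M}. g m)"
  proof -
    have "(\<Sum>u\<in>{t<..<M}. g (max t u - min t u)) = sum g ((\<lambda>u. u - t) ` {t<..<M})"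
      by (subst sum.reindex) (auto simp: inj_on_def)
    also have "\<dots> \<le> sum g {1..<M}"
      using assms by (intro sum_mono2) auto
    finally show ?thesis .
  qed
  ultimately show ?thesis
    by simp
qed

lemma power_mult_cnj_power:
  assumes "cmod a = 1"
  shows "a ^ t * cnj a ^ u = (if t \<le> u then cnj a ^ (u - t) else a ^ (t - u))"
proof -
  have "a * cnj a = 1"
    using assms by (simp add: complex_norm_square[symmetric])
  then have cancel: "a ^ m * cnj a ^ m = 1" for m
    by (simp flip: power_mult_distrib)
  show ?thesis
  proof (cases "t \<le> u")
    case True
    then have "cnj a ^ u = cnj a ^ t * cnj a ^ (u - t)"
      by (simp flip: power_add)
    then show ?thesis
      using True cancel[of t] by simp
  next
    case False
    then have "a ^ t = a ^ (t - u) * a ^ u"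
      by (simp flip: power_add)
    then show ?thesis
      using False cancel[of u] by simp
  qed
qed

text \<open>Exchanging the two exponents conjugates the sum, so its modulus depends only on their
  distance.\<close>

lemma norm_sum_power_mult_cnj_power:
  assumes "\<And>k. k < n \<Longrightarrow> cmod (a k) = 1"
  shows "cmod (\<Sum>k<n. a k ^ t * cnj (a k) ^ u) = cmod (power_sum n a (max t u - min t u))"
proof (cases "t \<le> u")
  case True
  then show ?thesis
    using assms by (simp add: power_mult_cnj_power power_sum_def)
next
  case False
  then have "(\<Sum>k<n. a k ^ t * cnj (a k) ^ u) = cnj (power_sum n a (t - u))"
    using assms by (simp add: power_mult_cnj_power power_sum_def)
  then show ?thesis
    using False by simp
qed

text \<open>Positivity of the Fejer kernel: in the double sum over pairs of points every term is
  nonnegative, and the diagonal alone contributes \<open>n * M\<^sup>2\<close>.\<close>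

lemma fejer_lower_bound:
  assumes unit: "\<And>k. k < n \<Longrightarrow> cmod (a k) = 1"
  shows "real n * real M \<le> (real n)\<^sup>2 + 2 * (\<Sum>m\<in>{1..<M}. (cmod (power_sum n a m))\<^sup>2)"
proof (cases "M = 0")
  case False
  define D where "D j k = (\<Sum>t<M. (a j * cnj (a k)) ^ t)" for j k
  define g where "g m = (cmod (power_sum n a m))\<^sup>2" for m
  have "real n * (real M)\<^sup>2 = (\<Sum>j<n. (cmod (D j j))\<^sup>2)"
  proof -
    have "D j j = of_nat M" if "j < n" for j
      using unit[OF that] by (simp add: D_def complex_norm_square[symmetric])
    then show ?thesis
      by simp
  qed
  also have "\<dots> \<le> (\<Sum>j<n. \<Sum>k<n. (cmod (D j k))\<^sup>2)"
    by (intro sum_mono member_le_sum) auto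
  \<comment> \<open>Each summand factors into a part in \<open>j\<close> and the conjugate
    expression in \<open>k\<close>. Bringing the sums over points inside leaves a squared modulus
    for every pair of exponents.\<close>
  also have "\<dots> = (\<Sum>t<M. \<Sum>u<M. (cmod (\<Sum>k<n. a k ^ t * cnj (a k) ^ u))\<^sup>2)"
  proof -
    have "(\<Sum>j<n. \<Sum>k<n. complex_of_real ((cmod (D j k))\<^sup>2))
        = (\<Sum>j<n. \<Sum>k<n. \<Sum>t<M. \<Sum>u<M. (a j ^ t * cnj (a j) ^ u) * (cnj (a k) ^ t * a k ^ u))"
      unfolding complex_norm_square
      by (simp add: D_def sum_product power_mult_distrib mult_ac)
    also have "\<dots> = (\<Sum>j<n. \<Sum>t<M. \<Sum>k<n. \<Sum>u<M. (a j ^ t * cnj (a j) ^ u) * (cnj (a k) ^ t * a k ^ u))"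
      by (rule sum.cong[OF refl], rule sum.swap)
    also have "\<dots> = (\<Sum>t<M. \<Sum>j<n. \<Sum>k<n. \<Sum>u<M. (a j ^ t * cnj (a j) ^ u) * (cnj (a k) ^ t * a k ^ u))"
      by (rule sum.swap)
    also have "\<dots> = (\<Sum>t<M. \<Sum>j<n. \<Sum>u<M. \<Sum>k<n. (a j ^ t * cnj (a j) ^ u) * (cnj (a k) ^ t * a k ^ u))"
      by (rule sum.cong[OF refl], rule sum.cong[OF refl], rule sum.swap)
    also have "\<dots> = (\<Sum>t<M. \<Sum>u<M. \<Sum>j<n. \<Sum>k<n. (a j ^ t * cnj (a j) ^ u) * (cnj (a k) ^ t * a k ^ u))"
      by (rule sum.cong[OF refl], rule sum.swap)
    also have "\<dots> = (\<Sum>t<M. \<Sum>u<M. complex_of_real ((cmod (\<Sum>k<n. a k ^ t * cnj (a k) ^ u))\<^sup>2))"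
      unfolding complex_norm_square by (simp add: sum_product)
    finally have "complex_of_real (\<Sum>j<n. \<Sum>k<n. (cmod (D j k))\<^sup>2)
        = complex_of_real (\<Sum>t<M. \<Sum>u<M. (cmod (\<Sum>k<n. a k ^ t * cnj (a k) ^ u))\<^sup>2)"
      by (simp only: of_real_sum)
    then show ?thesis
      by (simp only: of_real_eq_iff)
  qed
  also have "\<dots> = (\<Sum>t<M. \<Sum>u<M. g (max t u - min t u))"
    by (simp add: norm_sum_power_mult_cnj_power[OF unit] g_def)
  also have "\<dots> \<le> (\<Sum>t<M. g 0 + 2 * (\<Sum>m\<in>{1..<M}. g m))"
    by (intro sum_mono sum_distance_le) (auto simp: g_def)
  \<comment> \<open>The power sum of order 0 is \<open>n\<close>, whence \<open>g 0\<close> is its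
    square.\<close>
  also have "\<dots> = real M * ((real n)\<^sup>2 + 2 * (\<Sum>m\<in>{1..<M}. g m))"
    by (simp add: g_def power_sum_def)
  finally have "real M * (real n * real M) \<le> real M * ((real n)\<^sup>2 + 2 * (\<Sum>m\<in>{1..<M}. g m))"
    by (simp add: power2_eq_square mult_ac)
  then show ?thesis
    unfolding g_def by (rule mult_left_le_imp_le) (use False in simp)
qed simp

lemma norm_power_sum_le:
  assumes "\<And>k. k < n \<Longrightarrow> cmod (a k) = 1"
  shows "cmod (power_sum n a m) \<le> real n"
proof -
  have "cmod (power_sum n a m) \<le> (\<Sum>k<n. cmod (cnj (a k) ^ m))"
    unfolding power_sum_def by (rule norm_sum)
  also have "\<dots> = real n"
    using assms by (simp add: norm_power)
  finally show ?thesis .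
qed

text \<open>With \<open>M = (2 * N + 1) * n\<close> the Fejer bound gives at least
  \<open>N * n^2\<close> for the orders from 1 to \<open>M - 1\<close>. The orders below
  \<open>N\<close> account for at most \<open>(N - 1) * n^2\<close>, which leaves
  \<open>n^2\<close>.\<close>

lemma power_sums_lower_bound:
  assumes unit: "\<And>k. k < n \<Longrightarrow> cmod (a k) = 1" and "N \<ge> 1" and "n \<ge> 1"
  shows "(real n)\<^sup>2 \<le> (\<Sum>m\<in>{N..<(2 * N + 1) * n}. (cmod (power_sum n a m))\<^sup>2)"
proof -
  define M where "M = (2 * N + 1) * n"
  define g where "g m = (cmod (power_sum n a m))\<^sup>2" for m
  have "N * 1 \<le> (2 * N + 1) * n"
    using assms(3) by (intro mult_le_mono) auto
  then have "N \<le> M"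
    by (simp add: M_def)
  have "real n * real M \<le> (real n)\<^sup>2 + 2 * sum g {1..<M}"
    using fejer_lower_bound[OF unit, where M = M] by (simp add: g_def)
  moreover have "sum g {1..<M} = sum g {1..<N} + sum g {N..<M}"
    using assms(2) \<open>N \<le> M\<close> by (simp add: sum.atLeastLessThan_concat)
  moreover have "sum g {1..<N} \<le> (real N - 1) * (real n)\<^sup>2"
  proof -
    have "sum g {1..<N} \<le> (\<Sum>m\<in>{1..<N}. (real n)\<^sup>2)"
      using norm_power_sum_le[OF unit] unfolding g_def by (intro sum_mono power_mono) auto
    then show ?thesis
      using assms(2) by (simp add: of_nat_diff)
  qed
  ultimately have "(real n)\<^sup>2 \<le> sum g {N..<M}"
    by (simp add: M_def algebra_simps power2_eq_square)
  then show ?thesis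
    by (simp add: M_def g_def)
qed

text \<open>Up to conjugation this is a geometric sum of length \<open>n\<close> whose ratio
  \<open>w\<close> is an \<open>n\<close>-th root of unity, equal to 1 exactly when \<open>n\<close>
  divides \<open>m\<close>.\<close>

lemma norm_power_sum_roots_of_unity:
  assumes "n \<ge> 1"
  shows "cmod (power_sum n (\<lambda>k. exp (2 * of_real pi * \<i> * of_nat k / of_nat n)) m)
    = (if n dvd m then real n else 0)"
proof -
  define w where "w = exp (2 * of_real pi * \<i> * of_nat m / of_nat n)"
  have cnj_eq: "cnj (power_sum n (\<lambda>k. exp (2 * of_real pi * \<i> * of_nat k / of_nat n)) m) = (\<Sum>k<n. w ^ k)"
    unfolding power_sum_def w_def cnj_sum
    by (intro sum.cong refl) (simp add: exp_of_nat_mult[symmetric] mult_ac)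
  have "w ^ n = 1"
  proof -
    have "w ^ n = exp (2 * of_real pi * \<i>) ^ m"
      using assms by (simp add: w_def exp_of_nat_mult[symmetric] mult_ac)
    then show ?thesis
      by simp
  qed
  moreover have "w = 1 \<longleftrightarrow> n dvd m"
    unfolding w_def by (rule complex_root_unity_eq_1) fact
  ultimately have "(\<Sum>k<n. w ^ k) = (if n dvd m then of_nat n else 0)"
    by (cases "n dvd m") (simp_all add: geometric_sum)
  with cnj_eq show ?thesis
    by (metis complex_mod_cnj norm_of_nat norm_zero)
qed

section \<open>The weighted energy of the power sums\<close>

text \<open>By Parseval this is the squared norm of the sum of poles without its factor
  \<open>\<alpha> + 1\<close>.\<close>

definition energy :: "nat \<Rightarrow> real \<Rightarrow> nat \<Rightarrow> (nat \<Rightarrow> complex) \<Rightarrow> real" where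
  "energy N \<alpha> n a = (\<Sum>j. coeff_weight N \<alpha> j * (cmod (power_sum n a (j + N)))\<^sup>2)"

lemma coeff_weight_nonneg: "\<alpha> > -1 \<Longrightarrow> coeff_weight N \<alpha> j \<ge> 0"
  by (simp add: coeff_weight_def Beta_real_nonneg)

text \<open>The hypothesis on \<alpha> says exactly that the exponent
  \<open>2 * N - 3 - \<alpha>\<close> is below -1.\<close>

lemma summable_coeff_weight:
  assumes "N \<ge> 1" and "\<alpha> > 2 * (real N - 1)"
  shows "summable (coeff_weight N \<alpha>)"
proof -
  have "\<alpha> > -1"
    using assms by simp
  then obtain C where C: "\<And>j. coeff_weight N \<alpha> j \<le> C * real (j + N) powr (2 * real N - 3 - \<alpha>)"
    using coeff_weight_bounds[OF assms(1)] by blast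
  have "summable (\<lambda>j. real j powr (2 * real N - 3 - \<alpha>))"
    using assms by (simp add: summable_real_powr_iff)
  then have "summable (\<lambda>j. C * real (j + N) powr (2 * real N - 3 - \<alpha>))"
    by (intro summable_mult) (subst summable_iff_shift)
  then show ?thesis
    by (rule summable_comparison_test') (use C coeff_weight_nonneg[OF \<open>\<alpha> > -1\<close>] in auto)
qed

lemma energy_term_le:
  assumes "\<alpha> > -1" and "\<And>k. k < n \<Longrightarrow> cmod (a k) = 1"
  shows "coeff_weight N \<alpha> j * (cmod (power_sum n a m))\<^sup>2 \<le> coeff_weight N \<alpha> j * (real n)\<^sup>2"
  using norm_power_sum_le[OF assms(2)] coeff_weight_nonneg[OF assms(1)]
  by (intro mult_left_mono power_mono) auto

lemma summable_energy:
  assumes "N \<ge> 1" and "\<alpha> > 2 * (real N - 1)" and "\<And>k. k < n \<Longrightarrow> cmod (a k) = 1"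
  shows "summable (\<lambda>j. coeff_weight N \<alpha> j * (cmod (power_sum n a (j + N)))\<^sup>2)"
proof (rule summable_comparison_test')
  have "\<alpha> > -1"
    using assms by simp
  show "summable (\<lambda>j. coeff_weight N \<alpha> j * (real n)\<^sup>2)"
    by (intro summable_mult2 summable_coeff_weight assms)
  show "norm (coeff_weight N \<alpha> j * (cmod (power_sum n a (j + N)))\<^sup>2) \<le> coeff_weight N \<alpha> j * (real n)\<^sup>2" for j
    using energy_term_le[OF \<open>\<alpha> > -1\<close> assms(3)] coeff_weight_nonneg[OF \<open>\<alpha> > -1\<close>] by simp
qed

text \<open>Adding the expansions of the single poles gives Taylor coefficients that are multiples
  of power sums, and Parseval applies. From here on the problem concerns only the power
  sums.\<close>

lemma bergman_norm_sum_poles: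
  assumes "N \<ge> 1" and "\<alpha> > 2 * (real N - 1)" and unit: "\<And>k. k < n \<Longrightarrow> cmod (a k) = 1"
  shows "bergman_norm \<alpha> (\<lambda>z. \<Sum>k<n. 1 / (z - a k) ^ N) = sqrt ((\<alpha> + 1) * energy N \<alpha> n a)"
proof -
  define f where "f z = (\<Sum>k<n. 1 / (z - a k) ^ N)" for z
  define c where "c j = (- 1) ^ N * of_nat ((j + N - 1) choose (N - 1)) * power_sum n a (j + N)" for j
  have "\<alpha> > -1"
    using assms by simp
  have [measurable]: "f \<in> borel_measurable borel"
    unfolding f_def by measurable
  have sums: "(\<lambda>j. c j * z ^ j) sums f z" if "cmod z < 1" for z
  proof -
    have "(\<lambda>j. \<Sum>k<n. (- 1) ^ N * of_nat ((j + N - 1) choose (N - 1)) * cnj (a k) ^ (j + N) * z ^ j) sums f z"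
      unfolding f_def by (intro sums_sum sums_inverse_power_unit_pole) (use unit that assms in auto)
    then show ?thesis
      by (simp add: c_def power_sum_def sum_distrib_left sum_distrib_right)
  qed
  have weight: "(cmod (c j))\<^sup>2 * Beta (real j + 1) (\<alpha> + 1)
      = coeff_weight N \<alpha> j * (cmod (power_sum n a (j + N)))\<^sup>2" for j
    by (simp add: c_def coeff_weight_def norm_mult norm_power power_mult_distrib)
  have "(LINT z|disc_area. (cmod (f z))\<^sup>2 * (1 - (cmod z)\<^sup>2) powr \<alpha>)
      = (LINT z|bergman_measure \<alpha>. (cmod (f z))\<^sup>2)"
    unfolding bergman_measure_def by (subst integral_density) (auto simp: mult.commute)
  also have "\<dots> = energy N \<alpha> n a"
    using parseval_bergman_measure[OF \<open>\<alpha> > -1\<close> _ sums] summable_energy[OF assms]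
    by (simp add: weight energy_def)
  finally show ?thesis
    by (simp add: bergman_norm_def f_def)
qed

section \<open>Existence of a minimizing configuration\<close>

text \<open>Every term is continuous in finitely many coordinates, and \<open>n^2\<close> times the
  summable weights is a majorant independent of the points, so the series converges
  uniformly.\<close>

lemma continuous_on_energy:
  assumes "N \<ge> 1" and "\<alpha> > 2 * (real N - 1)"
  shows "continuous_on {a. \<forall>k. a k \<in> sphere 0 1} (energy N \<alpha> n)"
  unfolding energy_def
proof (rule uniform_limit_theorem)
  have "\<alpha> > -1"
    using assms by simp
  show "uniform_limit {a. \<forall>k. a k \<in> sphere 0 1}
      (\<lambda>J a. \<Sum>j<J. coeff_weight N \<alpha> j * (cmod (power_sum n a (j + N)))\<^sup>2)
      (\<lambda>a. \<Sum>j. coeff_weight N \<alpha> j * (cmod (power_sum n a (j + N)))\<^sup>2) sequentially"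
  proof (rule Weierstrass_m_test)
    show "summable (\<lambda>j. coeff_weight N \<alpha> j * (real n)\<^sup>2)"
      by (intro summable_mult2 summable_coeff_weight assms)
    show "norm (coeff_weight N \<alpha> j * (cmod (power_sum n a (j + N)))\<^sup>2) \<le> coeff_weight N \<alpha> j * (real n)\<^sup>2"
      if "a \<in> {a. \<forall>k. a k \<in> sphere 0 1}" for j a
      using energy_term_le[OF \<open>\<alpha> > -1\<close>, of n a] coeff_weight_nonneg[OF \<open>\<alpha> > -1\<close>] that by simp
  qed
  have "continuous_on S (\<lambda>a::nat \<Rightarrow> complex. a k)" for S k
    using continuous_on_product_coordinates by (rule continuous_on_subset) simp
  then show "\<forall>\<^sub>F J in sequentially. continuous_on {a. \<forall>k. a k \<in> sphere 0 1}
      (\<lambda>a. \<Sum>j<J. coeff_weight N \<alpha> j * (cmod (power_sum n a (j + N)))\<^sup>2)"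
    unfolding power_sum_def by (intro always_eventually allI continuous_intros)
qed simp

text \<open>Tychonoff's theorem for a product of circles. All coordinates are confined to the circle
  so that configurations can remain total sequences.\<close>

lemma compact_infinite_torus: "compact {a :: nat \<Rightarrow> complex. \<forall>k. a k \<in> sphere 0 1}"
proof -
  have "{a :: nat \<Rightarrow> complex. \<forall>k. a k \<in> sphere 0 1} = PiE UNIV (\<lambda>_. sphere 0 1)"
    by (auto simp: PiE_UNIV_domain)
  then have "compactin (product_topology (\<lambda>_. euclidean) UNIV) {a :: nat \<Rightarrow> complex. \<forall>k. a k \<in> sphere 0 1}"
    by (simp only: compactin_PiE) simp
  then show ?thesis
    by (simp add: euclidean_product_topology)
qed

lemma energy_minimum_exists:
  assumes "N \<ge> 1" and "\<alpha> > 2 * (real N - 1)"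
  shows "\<exists>a. (\<forall>k. cmod (a k) = 1) \<and> (\<forall>b. (\<forall>k<n. cmod (b k) = 1) \<longrightarrow> energy N \<alpha> n a \<le> energy N \<alpha> n b)"
proof -
  define K where "K = {a :: nat \<Rightarrow> complex. \<forall>k. a k \<in> sphere 0 1}"
  have "(\<lambda>_. 1) \<in> K"
    by (simp add: K_def)
  then have "K \<noteq> {}"
    by blast
  moreover have "compact K" "continuous_on K (energy N \<alpha> n)"
    using compact_infinite_torus continuous_on_energy[OF assms] by (simp_all add: K_def)
  ultimately obtain a where "a \<in> K" and min: "\<And>b. b \<in> K \<Longrightarrow> energy N \<alpha> n a \<le> energy N \<alpha> n b"
    using continuous_attains_inf[of K "energy N \<alpha> n"] by blast
  have "energy N \<alpha> n a \<le> energy N \<alpha> n b" if "\<forall>k<n. cmod (b k) = 1" for b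
  proof -
    \<comment> \<open>The energy reads only the first \<open>n\<close> points, so a competitor may
      be completed by 1 to lie in the compact set.\<close>
    have "energy N \<alpha> n a \<le> energy N \<alpha> n (\<lambda>k. if k < n then b k else 1)"
      using that by (intro min) (simp add: K_def)
    then show ?thesis
      by (simp add: energy_def power_sum_def)
  qed
  then show ?thesis
    using \<open>a \<in> K\<close> by (auto simp: K_def)
qed

section \<open>Matching bounds for the energy\<close>

text \<open>The orders from \<open>N\<close> up to \<open>(2 * N + 1) * n\<close> carry a total of
  at least \<open>n^2\<close>. The power bounding the weights from below decreases, so on this range
  it is at least its value at the upper end, a constant times
  \<open>n powr (2 * N - 3 - \<alpha>)\<close>.\<close>

lemma energy_lower_bound:
  assumes "N \<ge> 1" and "\<alpha> > 2 * (real N - 1)"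
  shows "\<exists>c>0. \<forall>n a. n \<ge> 1 \<longrightarrow> (\<forall>k<n. cmod (a k) = 1) \<longrightarrow>
    c * (real n)\<^sup>2 * real n powr (2 * real N - 3 - \<alpha>) \<le> energy N \<alpha> n a"
proof -
  define \<beta> where "\<beta> = 2 * real N - 3 - \<alpha>"
  have "\<alpha> > -1" "\<beta> \<le> 0"
    using assms by (simp_all add: \<beta>_def)
  then obtain c where "c > 0" and c: "\<And>j. c * real (j + N) powr \<beta> \<le> coeff_weight N \<alpha> j"
    using coeff_weight_bounds[OF assms(1)] unfolding \<beta>_def by blast
  have "c * real (2 * N + 1) powr \<beta> * (real n)\<^sup>2 * real n powr \<beta> \<le> energy N \<alpha> n a"
    if "n \<ge> 1" and unit: "\<And>k. k < n \<Longrightarrow> cmod (a k) = 1" for n a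
  proof -
    define M where "M = (2 * N + 1) * n"
    define g where "g m = (cmod (power_sum n a m))\<^sup>2" for m
    have "N * 1 \<le> (2 * N + 1) * n"
      using that(1) by (intro mult_le_mono) auto
    then have "N \<le> M"
      by (simp add: M_def)
    have "c * real M powr \<beta> * (real n)\<^sup>2 \<le> c * real M powr \<beta> * (\<Sum>m\<in>{N..<M}. g m)"
      using power_sums_lower_bound[OF unit assms(1) that(1)] \<open>c > 0\<close>
      by (intro mult_left_mono) (auto simp: M_def g_def)
    also have "(\<Sum>m\<in>{N..<M}. g m) = (\<Sum>j<M - N. g (j + N))"
      using sum.shift_bounds_nat_ivl[of g 0 N "M - N"] \<open>N \<le> M\<close> by (simp add: lessThan_atLeast0)
    also have "c * real M powr \<beta> * \<dots> \<le> (\<Sum>j<M - N. coeff_weight N \<alpha> j * g (j + N))"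
      unfolding sum_distrib_left
    proof (rule sum_mono)
      fix j assume "j \<in> {..<M - N}"
      then have "real M powr \<beta> \<le> real (j + N) powr \<beta>"
        using assms(1) \<open>\<beta> \<le> 0\<close> by (intro powr_mono2') auto
      then have "c * real M powr \<beta> \<le> coeff_weight N \<alpha> j"
        using c[of j] \<open>c > 0\<close> by (meson mult_left_mono less_imp_le order_trans)
      then show "c * real M powr \<beta> * g (j + N) \<le> coeff_weight N \<alpha> j * g (j + N)"
        by (intro mult_right_mono) (auto simp: g_def)
    qed
    also have "\<dots> \<le> energy N \<alpha> n a"
      unfolding energy_def g_def
      by (intro sum_le_suminf summable_energy assms unit)
         (auto simp: coeff_weight_nonneg[OF \<open>\<alpha> > -1\<close>])
    finally have "c * real M powr \<beta> * (real n)\<^sup>2 \<le> energy N \<alpha> n a" .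
    moreover have "real M powr \<beta> = real (2 * N + 1) powr \<beta> * real n powr \<beta>"
      by (simp only: M_def of_nat_mult powr_mult)
    ultimately show ?thesis
      by (simp only: mult_ac)
  qed
  moreover have "c * real (2 * N + 1) powr \<beta> > 0"
    using \<open>c > 0\<close> by simp
  ultimately show ?thesis
    unfolding \<beta>_def by blast
qed

text \<open>Only multiples \<open>l * n\<close> contribute, each with squared power sum
  \<open>n^2\<close> and weight at most a constant times
  \<open>(l * n) powr (2 * N - 3 - \<alpha>)\<close>; the sum over \<open>l\<close> converges and
  factors out.\<close>

lemma energy_roots_of_unity_upper_bound:
  assumes "N \<ge> 1" and "\<alpha> > 2 * (real N - 1)"
  shows "\<exists>C>0. \<forall>n\<ge>1. energy N \<alpha> n (\<lambda>k. exp (2 * of_real pi * \<i> * of_nat k / of_nat n))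
    \<le> C * (real n)\<^sup>2 * real n powr (2 * real N - 3 - \<alpha>)"
proof -
  define \<beta> where "\<beta> = 2 * real N - 3 - \<alpha>"
  have "\<alpha> > -1" "\<beta> < -1"
    using assms by (simp_all add: \<beta>_def)
  then obtain C where "C > 0" and C: "\<And>j. coeff_weight N \<alpha> j \<le> C * real (j + N) powr \<beta>"
    using coeff_weight_bounds[OF assms(1)] unfolding \<beta>_def by blast
  \<comment> \<open>The term for \<open>l = 0\<close> is 0 because \<open>0 powr \<beta>\<close> is
    0, so this is the zeta value at \<open>- \<beta>\<close>.\<close>
  define Z where "Z = (\<Sum>l. real l powr \<beta>)"
  have summable_Z: "summable (\<lambda>l. real l powr \<beta>)"
    using \<open>\<beta> < -1\<close> by (simp add: summable_real_powr_iff)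
  have "Z > 0"
    unfolding Z_def by (rule suminf_pos2[OF summable_Z, of 1]) auto
  have "energy N \<alpha> n (\<lambda>k. exp (2 * of_real pi * \<i> * of_nat k / of_nat n))
      \<le> C * Z * (real n)\<^sup>2 * real n powr \<beta>" if "n \<ge> 1" for n
  proof -
    define r where "r k = exp (2 * of_real pi * \<i> * of_nat k / of_nat n)" for k
    define h where "h m = real m powr \<beta> * (cmod (power_sum n r m))\<^sup>2" for m
    have unit: "cmod (r k) = 1" for k
      by (simp add: r_def)
    have h: "h m = (if n dvd m then real m powr \<beta> * (real n)\<^sup>2 else 0)" for m
      using norm_power_sum_roots_of_unity[OF that, of m] by (simp add: h_def r_def[abs_def])
    have "(\<lambda>l. h (l * n)) sums (Z * (real n powr \<beta> * (real n)\<^sup>2))"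
      using sums_mult2[OF summable_sums[OF summable_Z], of "real n powr \<beta> * (real n)\<^sup>2"] unfolding Z_def
      by (simp add: h powr_mult mult.assoc)
    moreover have "strict_mono (\<lambda>l. l * n)"
      using that by (simp add: strict_mono_def)
    moreover have "h m = 0" if "m \<notin> range (\<lambda>l. l * n)" for m
      using that by (auto simp: h dvd_def mult.commute)
    \<comment> \<open>As \<open>h\<close> vanishes off the multiples of \<open>n\<close>, the sum
      over these multiples is the sum over all orders.\<close>
    ultimately have h_sums: "h sums (Z * (real n powr \<beta> * (real n)\<^sup>2))"
      by (subst (asm) sums_mono_reindex)
    have "energy N \<alpha> n r \<le> (\<Sum>j. C * h (j + N))"
      unfolding energy_def
    proof (rule suminf_le)
      show "summable (\<lambda>j. C * h (j + N))"
        using h_sums by (intro summable_mult) (subst summable_iff_shift, rule sums_summable)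
      show "coeff_weight N \<alpha> j * (cmod (power_sum n r (j + N)))\<^sup>2 \<le> C * h (j + N)" for j
        using mult_right_mono[OF C[of j], of "(cmod (power_sum n r (j + N)))\<^sup>2"]
        by (simp add: h_def mult_ac)
    qed (intro summable_energy assms unit)
    \<comment> \<open>The energy starts at order \<open>N\<close>; the missing initial terms of
      \<open>h\<close> are nonnegative, so completing the series can only increase it.\<close>
    also have "\<dots> = C * (suminf h - sum h {..<N})"
      using suminf_minus_initial_segment[OF sums_summable[OF h_sums], of N] sums_summable[OF h_sums]
      by (simp add: suminf_mult summable_iff_shift)
    also have "\<dots> \<le> C * suminf h"
      using \<open>C > 0\<close> by (intro mult_left_mono) (auto simp: h_def intro: sum_nonneg)
    also have "suminf h = Z * (real n powr \<beta> * (real n)\<^sup>2)"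
      using h_sums by (rule sums_unique[symmetric])
    finally show ?thesis
      by (simp add: r_def[abs_def] mult_ac)
  qed
  then show ?thesis
    using \<open>C > 0\<close> \<open>Z > 0\<close> unfolding \<beta>_def by (intro exI[of _ "C * Z"]) auto
qed

theorem theorem1p6:
  fixes N :: nat and \<alpha> :: real
  assumes "N \<ge> 1" and "\<alpha> > 2 * (real N - 1)"
  shows "\<exists>c>0. \<exists>C>0. \<forall>n::nat. n \<ge> 1 \<longrightarrow>
    (\<exists>a :: nat \<Rightarrow> complex.
       is_arg_min (\<lambda>b. bergman_norm \<alpha> (\<lambda>z. \<Sum>k<n. 1 / (z - b k) ^ N))
         (\<lambda>b. \<forall>k<n. b k \<in> sphere 0 1) a \<and>
       c * bergman_norm \<alpha> (Psi N n) \<le> bergman_norm \<alpha> (\<lambda>z. \<Sum>k<n. 1 / (z - a k) ^ N) \<and>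
       bergman_norm \<alpha> (\<lambda>z. \<Sum>k<n. 1 / (z - a k) ^ N) \<le> C * bergman_norm \<alpha> (Psi N n))"
proof -
  define \<beta> where "\<beta> = 2 * real N - 3 - \<alpha>"
  have "\<alpha> > -1"
    using assms by simp
  obtain c where "c > 0"
    and c: "\<And>n a. n \<ge> 1 \<Longrightarrow> (\<forall>k<n. cmod (a k) = 1) \<Longrightarrow>
      c * (real n)\<^sup>2 * real n powr \<beta> \<le> energy N \<alpha> n a"
    using energy_lower_bound[OF assms] unfolding \<beta>_def by blast
  define r :: "nat \<Rightarrow> nat \<Rightarrow> complex"
    where "r n k = exp (2 * of_real pi * \<i> * of_nat k / of_nat n)" for n k
  obtain C where "C > 0"
    and C: "\<And>n. n \<ge> 1 \<Longrightarrow> energy N \<alpha> n (r n) \<le> C * (real n)\<^sup>2 * real n powr \<beta>"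
    using energy_roots_of_unity_upper_bound[OF assms] unfolding \<beta>_def r_def[abs_def] by blast
  have unit: "cmod (r n k) = 1" for n k
    by (simp add: r_def)
  have Psi: "bergman_norm \<alpha> (Psi N n) = sqrt ((\<alpha> + 1) * energy N \<alpha> n (r n))" for n
    using bergman_norm_sum_poles[OF assms, of n "r n"] unit by (simp add: Psi_def[abs_def] r_def[abs_def])
  \<comment> \<open>The upper constant is 1 since the roots of unity compete for the minimum. The
    lower one is the square root of the ratio of the two energy bounds, whose common factor in
    \<open>n\<close> cancels.\<close>
  have "\<exists>a. is_arg_min (\<lambda>b. bergman_norm \<alpha> (\<lambda>z. \<Sum>k<n. 1 / (z - b k) ^ N))
         (\<lambda>b. \<forall>k<n. b k \<in> sphere 0 1) a \<and>
       sqrt (c / C) * bergman_norm \<alpha> (Psi N n) \<le> bergman_norm \<alpha> (\<lambda>z. \<Sum>k<n. 1 / (z - a k) ^ N) \<and>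
       bergman_norm \<alpha> (\<lambda>z. \<Sum>k<n. 1 / (z - a k) ^ N) \<le> 1 * bergman_norm \<alpha> (Psi N n)"
    if "n \<ge> 1" for n
  proof -
    obtain a where a: "\<And>k. cmod (a k) = 1"
      and min: "\<And>b. (\<forall>k<n. cmod (b k) = 1) \<Longrightarrow> energy N \<alpha> n a \<le> energy N \<alpha> n b"
      using energy_minimum_exists[OF assms] by blast
    have le: "bergman_norm \<alpha> (\<lambda>z. \<Sum>k<n. 1 / (z - a k) ^ N) \<le> bergman_norm \<alpha> (\<lambda>z. \<Sum>k<n. 1 / (z - b k) ^ N)"
      if "\<forall>k<n. b k \<in> sphere 0 1" for b
      using that min[of b] a \<open>\<alpha> > -1\<close> by (simp add: bergman_norm_sum_poles[OF assms])
    have "c / C * energy N \<alpha> n (r n) \<le> c / C * (C * (real n)\<^sup>2 * real n powr \<beta>)"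
      using C[OF that] \<open>c > 0\<close> \<open>C > 0\<close> by (intro mult_left_mono) auto
    also have "\<dots> \<le> energy N \<alpha> n a"
      using c[OF that, of a] a \<open>C > 0\<close> by (simp add: field_simps)
    finally have "c / C * ((\<alpha> + 1) * energy N \<alpha> n (r n)) \<le> (\<alpha> + 1) * energy N \<alpha> n a"
      using mult_left_mono[of "c / C * energy N \<alpha> n (r n)" "energy N \<alpha> n a" "\<alpha> + 1"] \<open>\<alpha> > -1\<close>
      by (simp add: mult_ac)
    then have "sqrt (c / C) * bergman_norm \<alpha> (Psi N n) \<le> bergman_norm \<alpha> (\<lambda>z. \<Sum>k<n. 1 / (z - a k) ^ N)"
      unfolding Psi bergman_norm_sum_poles[OF assms a] by (simp flip: real_sqrt_mult)
    moreover have "bergman_norm \<alpha> (\<lambda>z. \<Sum>k<n. 1 / (z - a k) ^ N) \<le> 1 * bergman_norm \<alpha> (Psi N n)"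
      unfolding Psi bergman_norm_sum_poles[OF assms a] using min[of "r n"] unit \<open>\<alpha> > -1\<close> by simp
    ultimately show ?thesis
      using a le by (intro exI[of _ a]) (auto simp: is_arg_min_def not_less)
  qed
  moreover have "sqrt (c / C) > 0"
    using \<open>c > 0\<close> \<open>C > 0\<close> by simp
  ultimately show ?thesis
    by (intro exI[of _ "sqrt (c / C)"] exI[of _ 1] conjI) auto
qed

end
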